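(* For all integers $k\ge 2$ and $n\ge k+1$, \[P^{n,k}(r)=r^{N-k}+P^{n-1,k-1}(r),\qquad N=\binom{n}{2}.\]
   Context: For an integer $n\ge 2$ let $N=\binom{n}{2}$. The edges $(i,j)$, $1\le i<j\le n$, of $K_n$ are ordered lexicographically $(1,2),(1,3),\dots,(1,n),(2,3),\dots,(n-1,n)$; $(i,j)$ has index $\mathrm{idx}(i,j)=(i-1)n-\binom{i}{2}+(j-i)$. For a binary string $\mathbf{x}=(x_1,\dots,x_n)$, the cut vector $\delta(\mathbf{x})\in\{0,1\}^N$ has entry $1$ at position $\mathrm{idx}(i,j)$ iff $x_i\ne x_j$. For $\delta\in\{0,1\}^N$ and a variable $r$, $W^n(\delta;r)=\sum_{i=1}^N\delta_i r^{N-i}$. For $1\le k\le n$, $C_k=\delta(1^k0^{n-k})$ in $K_n$ ($k$ ones followed by $n-k$ zeros). For $1\le k\le n-1$, $P^{n,k}(r)=W^n(C_k;r)-W^n(C_{k+1};r)$ (with all objects formed in $K_n$; $P^{n-1,k-1}$ is formed analogously in $K_{n-1}$). *)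

theory Defs
  imports Complex_Main
begin

text \<open>
  Binary strings and \<open>{0,1}\<close>-vectors are Boolean lists, with True for 1 and False for 0.
  Vertices, edge indices and vector positions are 1-based as in the source, whereas list access
  is 0-based; hence entry \<open>m\<close> of \<open>xs\<close> is \<open>xs ! (m - 1)\<close>.
\<close>

text \<open>
  For \<open>1 \<le> i < j \<le> n\<close> none of the subtractions truncates, because \<open>i choose 2 \<le> (i - 1) * n\<close>.
\<close>

definition edge_idx :: "nat \<Rightarrow> nat \<Rightarrow> nat \<Rightarrow> nat" where
  "edge_idx n i j = (i - 1) * n - (i choose 2) + (j - i)"

definition cut_vector :: "nat \<Rightarrow> bool list \<Rightarrow> bool list" where
  "cut_vector n x =
     map (\<lambda>m. \<exists>i j. 1 \<le> i \<and> i < j \<and> j \<le> n \<and> m = edge_idx n i j \<and> x ! (i - 1) \<noteq> x ! (j - 1))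
       [1..<(n choose 2) + 1]"

text \<open>
  The variable \<open>r\<close> ranges over an arbitrary commutative ring; the indeterminate of a polynomial
  ring is one instance.
\<close>

definition weight :: "nat \<Rightarrow> bool list \<Rightarrow> 'a::comm_ring_1 \<Rightarrow> 'a" where
  "weight n \<delta> r = (\<Sum>i = 1..n choose 2. of_bool (\<delta> ! (i - 1)) * r ^ ((n choose 2) - i))"

definition prefix_cut :: "nat \<Rightarrow> nat \<Rightarrow> bool list" where
  "prefix_cut n k = cut_vector n (replicate k True @ replicate (n - k) False)"

definition weight_diff :: "nat \<Rightarrow> nat \<Rightarrow> 'a::comm_ring_1 \<Rightarrow> 'a" where
  "weight_diff n k r = weight n (prefix_cut n k) r - weight n (prefix_cut n (k + 1)) r"

end

(* The edges at vertex 1 occupy the first n - 1 positions of a cut vector of K_n, and deleting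
   vertex 1 shifts the index of every other edge by exactly n - 1. So the weight of a cut in K_n is
   the weight of its star at vertex 1 plus the weight of the cut that it induces in K_(n-1). The
   stars of C_k and C_(k+1) at vertex 1 differ only in the edge (1, k + 1), which has index k. *)

theory Submission
  imports Defs
begin

text \<open>Guards the natural-number subtraction in \<open>edge_idx\<close> against truncation, on
  which the index shift below depends.\<close>

lemma choose_two_le_mult: "i choose 2 \<le> (i - 1) * n" if "i \<le> n"
proof -
  have "i choose 2 \<le> i * (i - 1)"
    by (simp add: choose_two)
  also have "\<dots> \<le> (i - 1) * n"
    using that by simp
  finally show ?thesis .
qed

lemma edge_idx_1: "edge_idx n 1 j = j - 1"
  by (simp add: edge_idx_def binomial_eq_0)

lemma edge_idx_pos: "edge_idx n i j \<ge> 1" if "i < j"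
  using that by (simp add: edge_idx_def)

text \<open>The product term becomes \<open>i * Suc n = (i - 1) * n + n + i\<close>, and by Pascal's
  rule the subtracted binomial grows by \<open>i\<close>; the two \<open>i\<close> cancel and
  \<open>n\<close> remains.\<close>

lemma edge_idx_Suc_Suc:
  assumes "1 \<le> i" "i \<le> n"
  shows "edge_idx (Suc n) (Suc i) (Suc j) = n + edge_idx n i j"
proof -
  obtain i' where i: "i = Suc i'"
    using assms(1) by (cases i) auto
  have "Suc i choose 2 = (i choose 2) + i"
    by (simp add: numeral_2_eq_2)
  moreover have "i choose 2 \<le> i' * n"
    using choose_two_le_mult[OF assms(2)] i by simp
  ultimately show ?thesis
    by (simp add: edge_idx_def i)
qed

lemma cut_vector_nth:
  assumes "1 \<le> m" "m \<le> n choose 2"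
  shows "cut_vector n x ! (m - 1) \<longleftrightarrow>
    (\<exists>i j. 1 \<le> i \<and> i < j \<and> j \<le> n \<and> m = edge_idx n i j \<and> x ! (i - 1) \<noteq> x ! (j - 1))"
  using assms by (simp add: cut_vector_def del: upt_Suc)

text \<open>The existential in \<open>cut_vector\<close> has a single candidate here: an edge
  avoiding vertex 1 has index greater than \<open>n\<close>, so \<open>(1, m + 1)\<close> is the
  only edge of index \<open>m\<close>.\<close>

lemma cut_vector_nth_star:
  assumes "1 \<le> m" "m \<le> n"
  shows "cut_vector (Suc n) (b # y) ! (m - 1) \<longleftrightarrow> b \<noteq> y ! (m - 1)"
proof -
  have le: "m \<le> Suc n choose 2"
    using assms(2) by (simp add: numeral_2_eq_2)
  have "i = 1 \<and> j = Suc m"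
    if "1 \<le> i" "i < j" "j \<le> Suc n" "m = edge_idx (Suc n) i j" for i j
  proof (cases "i = 1")
    case True
    with that show ?thesis by (simp only: edge_idx_1) simp
  next
    case False
    with \<open>1 \<le> i\<close> \<open>i < j\<close> \<open>j \<le> Suc n\<close>
    obtain i' j' where ij: "i = Suc i'" "j = Suc j'" "1 \<le> i'" "i' < j'" "j' \<le> n"
      by (intro that[of "i - 1" "j - 1"]) auto
    then have "m = n + edge_idx n i' j'"
      using that by (simp add: edge_idx_Suc_Suc)
    then show ?thesis
      using edge_idx_pos[OF ij(4), of n] assms(2) by simp
  qed
  moreover have "m = edge_idx (Suc n) 1 (Suc m)"
    by (simp only: edge_idx_1)
  ultimately have "(\<exists>i j. 1 \<le> i \<and> i < j \<and> j \<le> Suc n \<and> m = edge_idx (Suc n) i j \<and>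
      (b # y) ! (i - 1) \<noteq> (b # y) ! (j - 1)) \<longleftrightarrow> (b # y) ! (1 - 1) \<noteq> (b # y) ! (Suc m - 1)"
    using assms by (metis Suc_le_mono le_refl less_Suc_eq_le)
  also have "\<dots> \<longleftrightarrow> b \<noteq> y ! (m - 1)"
    using assms(1) by (simp add: nth_Cons')
  finally show ?thesis
    unfolding cut_vector_nth[OF assms(1) le] .
qed

text \<open>The map \<open>(i, j)\<close> to \<open>(i + 1, j + 1)\<close> carries witnesses of the
  right-hand existential to witnesses of the left-hand one, and every left-hand witness arises in
  this way.\<close>

lemma cut_vector_nth_rest:
  assumes "1 \<le> m" "m \<le> n choose 2"
  shows "cut_vector (Suc n) (b # y) ! (n + m - 1) \<longleftrightarrow> cut_vector n y ! (m - 1)"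
proof -
  have le: "1 \<le> n + m" "n + m \<le> Suc n choose 2"
    using assms by (auto simp: numeral_2_eq_2)
  have "cut_vector n y ! (m - 1)"
    if L: "cut_vector (Suc n) (b # y) ! (n + m - 1)"
  proof -
    from L obtain i j where ij: "1 \<le> i" "i < j" "j \<le> Suc n" "n + m = edge_idx (Suc n) i j"
      "(b # y) ! (i - 1) \<noteq> (b # y) ! (j - 1)"
      unfolding cut_vector_nth[OF le] by blast
    \<comment> \<open>For \<open>i = 1\<close> the index would be \<open>j - 1 \<le> n\<close>,
      which is less than \<open>n + m\<close>.\<close>
    have "i \<noteq> 1"
      using ij assms(1) edge_idx_1[of "Suc n" j] by auto
    with ij(1-3) obtain i' j' where
      ij': "i = Suc i'" "j = Suc j'" "1 \<le> i'" "i' < j'" "j' \<le> n"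
      by (intro that[of "i - 1" "j - 1"]) auto
    then have "m = edge_idx n i' j'" "y ! (i' - 1) \<noteq> y ! (j' - 1)"
      using ij by (auto simp: edge_idx_Suc_Suc nth_Cons')
    with ij' show ?thesis
      unfolding cut_vector_nth[OF assms] by blast
  qed
  moreover have "cut_vector (Suc n) (b # y) ! (n + m - 1)"
    if R: "cut_vector n y ! (m - 1)"
  proof -
    from R obtain i j where ij: "1 \<le> i" "i < j" "j \<le> n" "m = edge_idx n i j"
      "y ! (i - 1) \<noteq> y ! (j - 1)"
      unfolding cut_vector_nth[OF assms] by blast
    then have "1 \<le> Suc i" "Suc i < Suc j" "Suc j \<le> Suc n"
      "n + m = edge_idx (Suc n) (Suc i) (Suc j)"
      "(b # y) ! (Suc i - 1) \<noteq> (b # y) ! (Suc j - 1)"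
      by (auto simp: edge_idx_Suc_Suc nth_Cons')
    then show ?thesis
      unfolding cut_vector_nth[OF le] by blast
  qed
  ultimately show ?thesis by blast
qed

lemma weight_cut_vector_Cons:
  fixes r :: "'a::comm_ring_1"
  shows "weight (Suc n) (cut_vector (Suc n) (b # y)) r =
    (\<Sum>m = 1..n. of_bool (b \<noteq> y ! (m - 1)) * r ^ ((Suc n choose 2) - m)) +
    weight n (cut_vector n y) r"
proof -
  define f where "f m = of_bool (cut_vector (Suc n) (b # y) ! (m - 1)) *
    r ^ ((Suc n choose 2) - m)" for m
  have N: "Suc n choose 2 = n + (n choose 2)"
    by (simp add: numeral_2_eq_2)
  have "weight (Suc n) (cut_vector (Suc n) (b # y)) r = (\<Sum>m = 1..n + (n choose 2). f m)"
    by (simp add: weight_def f_def N)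
  also have "\<dots> = (\<Sum>m = 1..n. f m) + (\<Sum>m = n + 1..n + (n choose 2). f m)"
    by (rule sum.ub_add_nat) simp
  also have "(\<Sum>m = n + 1..n + (n choose 2). f m) = (\<Sum>m = 1..n choose 2. f (n + m))"
    using sum.shift_bounds_cl_nat_ivl[of f 1 n "n choose 2"] by (simp add: add.commute)
  also have "\<dots> = weight n (cut_vector n y) r"
    unfolding weight_def
  proof (rule sum.cong)
    fix m assume "m \<in> {1..n choose 2}"
    then have m: "1 \<le> m" "m \<le> n choose 2" by auto
    \<comment> \<open>The total number of edges also grows by \<open>n\<close>, so the shift cancels
      in the exponent and the powers of \<open>r\<close> are those of the smaller graph.\<close>
    show "f (n + m) = of_bool (cut_vector n y ! (m - 1)) * r ^ ((n choose 2) - m)"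
      unfolding f_def cut_vector_nth_rest[OF m] N by simp
  qed simp
  also have "(\<Sum>m = 1..n. f m) =
      (\<Sum>m = 1..n. of_bool (b \<noteq> y ! (m - 1)) * r ^ ((Suc n choose 2) - m))"
    unfolding f_def by (rule sum.cong) (simp_all only: atLeastAtMost_iff cut_vector_nth_star)
  finally show ?thesis .
qed

text \<open>Removing the leading one from the string leaves \<open>k\<close> ones followed by
  \<open>n - k\<close> zeros, so the induced cut is again a prefix cut.\<close>

lemma weight_prefix_cut_Suc:
  fixes r :: "'a::comm_ring_1"
  assumes "k \<le> n"
  shows "weight (Suc n) (prefix_cut (Suc n) (Suc k)) r =
    (\<Sum>m = Suc k..n. r ^ ((Suc n choose 2) - m)) + weight n (prefix_cut n k) r"
proof -
  let ?y = "replicate k True @ replicate (n - k) False"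
  have "(\<Sum>m = 1..n. of_bool (True \<noteq> ?y ! (m - 1)) * r ^ ((Suc n choose 2) - m)) =
      (\<Sum>m = Suc k..n. r ^ ((Suc n choose 2) - m))"
    \<comment> \<open>Entry \<open>m - 1\<close> of \<open>?y\<close> is True exactly for
      \<open>m \<le> k\<close> within the range, so those terms vanish.\<close>
    by (rule sum.mono_neutral_cong_right) (auto simp: nth_append)
  then show ?thesis
    using weight_cut_vector_Cons[of n True ?y r] by (simp add: prefix_cut_def)
qed

theorem mainTheorem6:
  fixes n k :: nat and r :: "'a::comm_ring_1"
  assumes "k \<ge> 2" and "n \<ge> k + 1"
  shows "weight_diff n k r = r ^ ((n choose 2) - k) + weight_diff (n - 1) (k - 1) r"
proof -
  obtain n' where n: "n = Suc n'"
    using assms by (cases n) auto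
  obtain k' where k: "k = Suc k'"
    using assms by (cases k) auto
  \<comment> \<open>This makes the decomposition applicable to both cuts and the star sum from
    \<open>Suc k'\<close> nonempty. Its first term, \<open>r ^ ((n choose 2) - k)\<close>, is all
    that survives subtracting the star sum from \<open>Suc (Suc k')\<close>.\<close>
  have "Suc k' \<le> n'"
    using assms n k by simp
  then show ?thesis
    by (simp add: n k weight_diff_def weight_prefix_cut_Suc sum.atLeast_Suc_atMost[of "Suc k'" n']
        algebra_simps)
qed

end
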